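(* Let $A_1,A_2,A_3$ be three non-concurrent non-null lines, and let $A_0$ be a non-null line distinct from $A_1,A_2,A_3$. Suppose that the points $A_0A_1$, $A_0A_2$, $A_0A_3$ are non-null and that their joins with the points $A_2A_3$, $A_1A_3$, $A_1A_2$ respectively are the lines $D_1,D_2,D_3$, and that $D_1,D_2,D_3$ are non-null. Define the spreads $$R_1\equiv S(A_2,D_1),\quad T_1\equiv S(D_1,A_3),\quad R_2\equiv S(A_3,D_2),\quad T_2\equiv S(D_2,A_1),\quad R_3\equiv S(A_1,D_3),\quad T_3\equiv S(D_3,A_2).$$ Then $$R_1R_2R_3=T_1T_2T_3.$$
   Context: Let $\mathbb F$ be a field of characteristic not two. A 3-proportion $x:y:z$ is a triple of elements of $\mathbb F$, not all zero, up to a common non-zero scalar. A point $a=[x:y:z]$ and a line $L=(l:m:n)$ are both 3-proportions. The point $[x:y:z]$ lies on the line $(l:m:n)$ when $lx+my-nz=0$. For distinct points, the join is the unique line through both; for distinct lines $L,M$, the meet $LM$ is the unique point lying on both. A point $[x:y:z]$ is null when $x^2+y^2-z^2=0$; a line $(l:m:n)$ is null when $l^2+m^2-n^2=0$. The spread between non-null lines $L_1=(l_1:m_1:n_1)$, $L_2=(l_2:m_2:n_2)$ is $$S(L_1,L_2)=1-\frac{(l_1l_2+m_1m_2-n_1n_2)^2}{(l_1^2+m_1^2-n_1^2)(l_2^2+m_2^2-n_2^2)};$$ it is undefined if either line is null. *)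

theory Defs
  imports Main
begin

fun proportional :: "('a::field) \<times> 'a \<times> 'a \<Rightarrow> 'a \<times> 'a \<times> 'a \<Rightarrow> bool" where
  "proportional (x, y, z) (x', y', z') \<longleftrightarrow>
     (x, y, z) \<noteq> (0, 0, 0) \<and> (x', y', z') \<noteq> (0, 0, 0) \<and>
     (\<exists>c. c \<noteq> 0 \<and> x' = c * x \<and> y' = c * y \<and> z' = c * z)"

lemma proportional_refl_iff:
  "proportional (x, y, z) (x, y, z) \<longleftrightarrow> (x, y, z) \<noteq> ((0, 0, 0) :: ('a::field) \<times> 'a \<times> 'a)"
  by (auto intro: exI[of _ 1])

lemma part_equivp_proportional: "part_equivp (proportional :: ('a::field) \<times> 'a \<times> 'a \<Rightarrow> _)"
proof (rule part_equivpI)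
  show "\<exists>x. proportional x (x :: 'a \<times> 'a \<times> 'a)"
    by (rule exI[of _ "(1, 1, 1)"]) (simp add: proportional_refl_iff)
  show "symp (proportional :: 'a \<times> 'a \<times> 'a \<Rightarrow> _)"
  proof (rule sympI, clarify)
    fix x y z x' y' z' :: 'a
    assume "proportional (x, y, z) (x', y', z')"
    then obtain c where "(x, y, z) \<noteq> (0, 0, 0)" "(x', y', z') \<noteq> (0, 0, 0)" "c \<noteq> 0"
      "x' = c * x" "y' = c * y" "z' = c * z" by auto
    then show "proportional (x', y', z') (x, y, z)"
      by (auto intro!: exI[of _ "inverse c"] simp: field_simps)
  qed
  show "transp (proportional :: 'a \<times> 'a \<times> 'a \<Rightarrow> _)"
  proof (rule transpI, clarify)
    fix x y z x' y' z' x'' y'' z'' :: 'a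
    assume "proportional (x, y, z) (x', y', z')" "proportional (x', y', z') (x'', y'', z'')"
    then obtain c d where "(x, y, z) \<noteq> (0, 0, 0)" "(x'', y'', z'') \<noteq> (0, 0, 0)"
      "c \<noteq> 0" "x' = c * x" "y' = c * y" "z' = c * z"
      "d \<noteq> 0" "x'' = d * x'" "y'' = d * y'" "z'' = d * z'" by auto
    then show "proportional (x, y, z) (x'', y'', z'')"
      by (auto intro!: exI[of _ "d * c"])
  qed
qed

quotient_type (overloaded) 'a proportion = "('a::field) \<times> 'a \<times> 'a" / partial: proportional
  by (rule part_equivp_proportional)

type_synonym 'a point = "'a proportion"
type_synonym 'a line = "'a proportion"

lift_definition lies_on :: "('a::field) point \<Rightarrow> 'a line \<Rightarrow> bool"
  is "\<lambda>(x, y, z) (l, m, n). l * x + m * y - n * z = 0"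
proof (clarify, goal_cases)
  case (1 x y z x' y' z' l m n l' m' n')
  then obtain c d where *: "c \<noteq> 0" "x' = c * x" "y' = c * y" "z' = c * z"
    "d \<noteq> 0" "l' = d * l" "m' = d * m" "n' = d * n" by auto
  have "l' * x' + m' * y' - n' * z' = (c * d) * (l * x + m * y - n * z)"
    unfolding * by (simp add: algebra_simps)
  then show ?case using * by simp
qed

definition join :: "('a::field) point \<Rightarrow> 'a point \<Rightarrow> 'a line" where
  "join a b = (THE L. lies_on a L \<and> lies_on b L)"

definition meet :: "('a::field) line \<Rightarrow> 'a line \<Rightarrow> 'a point" where
  "meet L M = (THE a. lies_on a L \<and> lies_on a M)"

definition concurrent :: "('a::field) line \<Rightarrow> 'a line \<Rightarrow> 'a line \<Rightarrow> bool" where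
  "concurrent L M N \<longleftrightarrow> (\<exists>a. lies_on a L \<and> lies_on a M \<and> lies_on a N)"

lemma quadratic_form_proportional:
  assumes "proportional (x, y, z) (x', y', z' :: 'a::field)"
  shows "x'\<^sup>2 + y'\<^sup>2 - z'\<^sup>2 = 0 \<longleftrightarrow> x\<^sup>2 + y\<^sup>2 - z\<^sup>2 = 0"
proof -
  obtain c where *: "c \<noteq> 0" "x' = c * x" "y' = c * y" "z' = c * z"
    using assms by auto
  have "x'\<^sup>2 + y'\<^sup>2 - z'\<^sup>2 = c\<^sup>2 * (x\<^sup>2 + y\<^sup>2 - z\<^sup>2)"
    unfolding * by (simp add: algebra_simps power2_eq_square)
  then show ?thesis using * by simp
qed

lift_definition null_point :: "('a::field) point \<Rightarrow> bool"
  is "\<lambda>(x, y, z). x\<^sup>2 + y\<^sup>2 - z\<^sup>2 = 0"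
  by (clarify, simp only: quadratic_form_proportional prod.case)

lift_definition null_line :: "('a::field) line \<Rightarrow> bool"
  is "\<lambda>(l, m, n). l\<^sup>2 + m\<^sup>2 - n\<^sup>2 = 0"
  by (clarify, simp only: quadratic_form_proportional prod.case)

text \<open>The spread is only meaningful for non-null lines; if a line is null, division by
  zero gives it the junk value 1.\<close>

lift_definition spread :: "('a::field) line \<Rightarrow> 'a line \<Rightarrow> 'a"
  is "\<lambda>(l1, m1, n1) (l2, m2, n2).
        1 - (l1 * l2 + m1 * m2 - n1 * n2)\<^sup>2 /
            ((l1\<^sup>2 + m1\<^sup>2 - n1\<^sup>2) * (l2\<^sup>2 + m2\<^sup>2 - n2\<^sup>2))"
proof (clarify, goal_cases)
  case (1 l1 m1 n1 l1' m1' n1' l2 m2 n2 l2' m2' n2')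
  then obtain c d where *: "c \<noteq> 0" "l1' = c * l1" "m1' = c * m1" "n1' = c * n1"
    "d \<noteq> 0" "l2' = d * l2" "m2' = d * m2" "n2' = d * n2" by auto
  have "(l1' * l2' + m1' * m2' - n1' * n2')\<^sup>2 = (c * d)\<^sup>2 * (l1 * l2 + m1 * m2 - n1 * n2)\<^sup>2"
    unfolding * by (simp add: algebra_simps power2_eq_square)
  moreover have "(l1'\<^sup>2 + m1'\<^sup>2 - n1'\<^sup>2) * (l2'\<^sup>2 + m2'\<^sup>2 - n2'\<^sup>2)
      = (c * d)\<^sup>2 * ((l1\<^sup>2 + m1\<^sup>2 - n1\<^sup>2) * (l2\<^sup>2 + m2\<^sup>2 - n2\<^sup>2))"
    unfolding * by (simp add: algebra_simps power2_eq_square)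
  ultimately show ?case using * by simp
qed

text \<open>Uniqueness of joins and meets, so that the definite descriptions above denote
  whenever the arguments are distinct.\<close>

lemma proportional_iff_cross:
  assumes "(x, y, z) \<noteq> (0, 0, 0)" "(x', y', z') \<noteq> (0, 0, 0 :: 'a::field)"
  shows "proportional (x, y, z) (x', y', z') \<longleftrightarrow>
    y * z' = z * y' \<and> z * x' = x * z' \<and> x * y' = y * x'"
proof
  assume R: "y * z' = z * y' \<and> z * x' = x * z' \<and> x * y' = y * x'"
  consider "x \<noteq> 0" | "y \<noteq> 0" | "z \<noteq> 0" using assms by auto
  then have "\<exists>c. x' = c * x \<and> y' = c * y \<and> z' = c * z"
  proof cases
    case 1
    then show ?thesis using R by (intro exI[of _ "x' / x"]) (auto simp: field_simps)
  next
    case 2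
    then show ?thesis using R by (intro exI[of _ "y' / y"]) (auto simp: field_simps)
  next
    case 3
    then show ?thesis using R by (intro exI[of _ "z' / z"]) (auto simp: field_simps)
  qed
  then show "proportional (x, y, z) (x', y', z')" using assms by auto
qed (auto simp: algebra_simps)

lemma lies_on_sym: "lies_on a L \<longleftrightarrow> lies_on L a"
  by transfer (auto simp: algebra_simps)

lemma ex_join:
  assumes "a \<noteq> b"
  shows "\<exists>L. lies_on a L \<and> lies_on b L"
  using assms
proof (transfer, clarify, goal_cases)
  case (1 x y z x' y' z')
  then have nz: "(x, y, z) \<noteq> (0, 0, 0)" "(x', y', z') \<noteq> (0, 0, 0)"
    by (auto simp only: proportional_refl_iff)
  define l m n where lmn: "l = y * z' - z * y'" "m = z * x' - x * z'" "n = y * x' - x * y'"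
  have "(l, m, n) \<noteq> (0, 0, 0)"
    using 1 unfolding proportional_iff_cross[OF nz] lmn by auto
  moreover have "l * x + m * y - n * z = 0" "l * x' + m * y' - n * z' = 0"
    unfolding lmn by (simp_all add: algebra_simps)
  ultimately show ?case
    by (intro bexI[of _ "(l, m, n)"]) (auto simp: in_respects proportional_refl_iff)
qed

lemma join_unique:
  assumes "a \<noteq> b" "lies_on a L" "lies_on b L" "lies_on a M" "lies_on b M"
  shows "L = M"
  using assms
proof (transfer, clarify, goal_cases)
  case (1 x y z x' y' z' l m n l' m' n')
  then have nz: "(x, y, z) \<noteq> (0, 0, 0)" "(x', y', z') \<noteq> (0, 0, 0)"
    and nz': "(l, m, n) \<noteq> (0, 0, 0)" "(l', m', n') \<noteq> (0, 0, 0)"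
    by (auto simp only: proportional_refl_iff)
  have eqs: "l * x + m * y - n * z = 0" "l * x' + m * y' - n * z' = 0"
    "l' * x + m' * y - n' * z = 0" "l' * x' + m' * y' - n' * z' = 0"
    using 1 by simp_all
  define p q r where pqr: "p = m * n' - n * m'" "q = n * l' - l * n'" "r = l * m' - m * l'"
  have par: "q * s = p * t \<and> r * s = - p * u \<and> r * t = - q * u"
    if "l * s + m * t - n * u = 0" "l' * s + m' * t - n' * u = 0" for s t u
  proof -
    have "q * s - p * t = n * (l' * s + m' * t - n' * u) - n' * (l * s + m * t - n * u)"
      "r * s + p * u = m' * (l * s + m * t - n * u) - m * (l' * s + m' * t - n' * u)"
      "r * t + q * u = l * (l' * s + m' * t - n' * u) - l' * (l * s + m * t - n * u)"
      unfolding pqr by (simp_all add: algebra_simps)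
    with that show ?thesis by (simp add: add_eq_0_iff2)
  qed
  have par': "q * x = p * y" "r * x = - p * z" "r * y = - q * z"
    "q * x' = p * y'" "r * x' = - p * z'" "r * y' = - q * z'"
    using par[OF eqs(1,3)] par[OF eqs(2,4)] by simp_all
  have "p * (x * y' - y * x') = x * (p * y') - (p * y) * x'"
    by (simp add: algebra_simps)
  also have "\<dots> = 0"
    unfolding par'[symmetric] by (simp add: algebra_simps)
  finally have off1: "p * (x * y' - y * x') = 0" .
  have "p * (z * x' - x * z') = x * (- p * z') - (- p * z) * x'"
    by (simp add: algebra_simps)
  also have "\<dots> = 0"
    unfolding par'[symmetric] by (simp add: algebra_simps)
  finally have off2: "p * (z * x' - x * z') = 0" .
  have "q * (y * z' - z * y') = (- q * z) * y' - y * (- q * z')"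
    by (simp add: algebra_simps)
  also have "\<dots> = 0"
    unfolding par'[symmetric] by (simp add: algebra_simps)
  finally have off3: "q * (y * z' - z * y') = 0" .
  have "q * (x * y' - y * x') = (q * x) * y' - y * (q * x')"
    by (simp add: algebra_simps)
  also have "\<dots> = 0"
    unfolding par' by (simp add: algebra_simps)
  finally have off4: "q * (x * y' - y * x') = 0" .
  have "r * (y * z' - z * y') = (r * y) * z' - z * (r * y')"
    by (simp add: algebra_simps)
  also have "\<dots> = 0"
    unfolding par' by (simp add: algebra_simps)
  finally have off5: "r * (y * z' - z * y') = 0" .
  have "r * (z * x' - x * z') = z * (r * x') - (r * x) * z'"
    by (simp add: algebra_simps)
  also have "\<dots> = 0"
    unfolding par' by (simp add: algebra_simps)
  finally have off6: "r * (z * x' - x * z') = 0" .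
  have "m * y - n * z = - (l * x)" "m' * y - n' * z = - (l' * x)"
    "m * y' - n * z' = - (l * x')" "m' * y' - n' * z' = - (l' * x')"
    "l * x - n * z = - (m * y)" "l' * x - n' * z = - (m' * y)"
    "l * x' - n * z' = - (m * y')" "l' * x' - n' * z' = - (m' * y')"
    "l * x + m * y = n * z" "l' * x + m' * y = n' * z"
    "l * x' + m * y' = n * z'" "l' * x' + m' * y' = n' * z'"
    using eqs by (simp_all add: algebra_simps eq_neg_iff_add_eq_0)
  note subst = this
  have "p * (y * z' - z * y') = (m * y' - n * z') * (m' * y - n' * z) - (m * y - n * z) * (m' * y' - n' * z')"
    "q * (z * x' - x * z') = (l * x' - n * z') * (l' * x - n' * z) - (l * x - n * z) * (l' * x' - n' * z')"
    "r * (x * y' - y * x') = (l * x + m * y) * (l' * x' + m' * y') - (l * x' + m * y') * (l' * x + m' * y)"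
    unfolding pqr by (simp_all add: algebra_simps)
  then have diag: "p * (y * z' - z * y') = 0" "q * (z * x' - x * z') = 0" "r * (x * y' - y * x') = 0"
    unfolding subst by (simp_all add: algebra_simps)
  have "p = 0 \<and> q = 0 \<and> r = 0"
    using 1(3) off1 off2 off3 off4 off5 off6 diag unfolding proportional_iff_cross[OF nz] by auto
  then show ?case
    unfolding proportional_iff_cross[OF nz'] pqr by simp
qed

lemma ex1_join: "a \<noteq> b \<Longrightarrow> \<exists>!L. lies_on a L \<and> lies_on b L"
  using ex_join join_unique by metis

lemma ex1_meet: "L \<noteq> M \<Longrightarrow> \<exists>!a. lies_on a L \<and> lies_on a M"
  using ex1_join[of L M] by (simp add: lies_on_sym)

end

theory Submission
  imports Defs "HOL-Library.Product_Plus"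
begin

text \<open>Represent \<open>A\<^sub>1\<close>, \<open>A\<^sub>2\<close>, \<open>A\<^sub>3\<close> by vectors \<open>v\<^sub>1\<close>, \<open>v\<^sub>2\<close>, \<open>v\<^sub>3\<close>. They form a basis because the
  lines are not concurrent, so \<open>A\<^sub>0\<close> is represented by some \<open>a v\<^sub>1 + b v\<^sub>2 + c v\<^sub>3\<close>. The line of
  \<open>b v\<^sub>2 + c v\<^sub>3\<close> belongs both to the pencil of \<open>A\<^sub>0\<close>, \<open>A\<^sub>1\<close> and to that of \<open>A\<^sub>2\<close>, \<open>A\<^sub>3\<close>, hence it is
  \<open>D\<^sub>1\<close>; similarly for \<open>D\<^sub>2\<close> and \<open>D\<^sub>3\<close>. Writing \<open>Q\<close> for the quadratic form and \<open>G\<close> for the Gram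
  determinant, \<open>S(u, s u + t v) = t\<^sup>2 G(u, v) / (Q(u) Q(s u + t v))\<close>, and
  all factors cancel in the product.\<close>

fun scale3 :: "'a::field \<Rightarrow> 'a \<times> 'a \<times> 'a \<Rightarrow> 'a \<times> 'a \<times> 'a" where
  "scale3 c (x, y, z) = (c * x, c * y, c * z)"

text \<open>One form serves two purposes: it is the incidence pairing of a point with a line, and on
  the diagonal it is the quadratic form that decides nullity.\<close>

fun lorentz :: "'a::field \<times> 'a \<times> 'a \<Rightarrow> 'a \<times> 'a \<times> 'a \<Rightarrow> 'a" where
  "lorentz (x, y, z) (x', y', z') = x * x' + y * y' - z * z'"

definition gram :: "'a::field \<times> 'a \<times> 'a \<Rightarrow> 'a \<times> 'a \<times> 'a \<Rightarrow> 'a" where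
  "gram u v = lorentz u u * lorentz v v - (lorentz u v)\<^sup>2"

lemma lorentz_commute: "lorentz u v = lorentz v u"
  by (cases u; cases v) (simp add: mult.commute)

lemma lorentz_add_right: "lorentz u (v + w) = lorentz u v + lorentz u w"
  by (cases u; cases v; cases w) (simp add: algebra_simps)

lemma lorentz_scale3_right: "lorentz u (scale3 c v) = c * lorentz u v"
  by (cases u; cases v) (simp add: algebra_simps)

lemma gram_commute: "gram u v = gram v u"
  by (simp add: gram_def lorentz_commute[of u v] mult.commute)

lemma gram_scale3_right: "gram u (scale3 c v) = c\<^sup>2 * gram u v"
  by (simp add: gram_def lorentz_scale3_right lorentz_commute[of "scale3 c v"]
      power2_eq_square algebra_simps)

text \<open>The shear from \<open>(u, v)\<close> to \<open>(u, s u + v)\<close> has determinant one,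
  and a Gram determinant changes by the square of the determinant.\<close>

lemma gram_add_scale3: "gram u (scale3 s u + v) = gram u v"
  unfolding gram_def lorentz_add_right lorentz_scale3_right lorentz_commute[of "_ + _"]
    lorentz_commute[of "scale3 s u"] lorentz_commute[of v u]
  by (simp add: power2_eq_square algebra_simps)

text \<open>The quotient is partial, so every \<open>abs_eq\<close> rule asks for self-related
  representatives; this turns that condition into being nonzero.\<close>

lemma proportional_self_iff: "proportional v v \<longleftrightarrow> v \<noteq> 0"
  by (cases v) (auto simp: zero_prod_def intro: exI[of _ 1])

lemma proportion_cases:
  obtains v where "v \<noteq> 0" "L = abs_proportion v"
  using Quotient3_abs_rep[OF Quotient3_proportion] Quotient3_rep_reflp[OF Quotient3_proportion]
    proportional_self_iff by metis

lemma lies_on_abs_proportion: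
  assumes "u \<noteq> 0" "v \<noteq> 0"
  shows "lies_on (abs_proportion u) (abs_proportion v) \<longleftrightarrow> lorentz u v = 0"
  using assms by (cases u; cases v)
    (simp add: lies_on.abs_eq proportional_self_iff mult.commute)

lemma null_line_abs_proportion:
  assumes "v \<noteq> 0"
  shows "null_line (abs_proportion v) \<longleftrightarrow> lorentz v v = 0"
  using assms by (cases v)
    (simp add: null_line.abs_eq proportional_self_iff power2_eq_square)

lemma spread_abs_proportion:
  assumes "u \<noteq> 0" "v \<noteq> 0" "lorentz u u \<noteq> 0" "lorentz v v \<noteq> 0"
  shows "spread (abs_proportion u) (abs_proportion v) =
    gram u v / (lorentz u u * lorentz v v)"
proof -
  have "spread (abs_proportion u) (abs_proportion v) =
      1 - (lorentz u v)\<^sup>2 / (lorentz u u * lorentz v v)"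
    using assms by (cases u; cases v)
      (simp add: spread.abs_eq proportional_self_iff power2_eq_square)
  also have "\<dots> = gram u v / (lorentz u u * lorentz v v)"
    using assms by (simp add: gram_def diff_divide_distrib)
  finally show ?thesis .
qed

lemma abs_proportion_scale3:
  assumes "v \<noteq> 0" "c \<noteq> 0"
  shows "abs_proportion (scale3 c v) = abs_proportion v"
proof -
  have "proportional v (scale3 c v)"
    using assms by (cases v) (auto simp: zero_prod_def)
  then show ?thesis
    using Quotient3_rel_abs[OF Quotient3_proportion] by metis
qed

lemma meet_lies_on:
  assumes "L \<noteq> M"
  shows "lies_on (meet L M) L" "lies_on (meet L M) M"
  using theI'[OF ex1_meet[OF assms]] by (simp_all add: meet_def)

lemma join_eqI:
  assumes "a \<noteq> b" "lies_on a L" "lies_on b L"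
  shows "join a b = L"
  unfolding join_def using assms by (blast intro: join_unique)

text \<open>The case \<open>L = M\<close> is what makes coinciding lines concurrent with any third
  line, so that non-concurrence forces distinctness.\<close>

lemma ex_lies_on_both: "\<exists>a. lies_on a L \<and> lies_on a M"
proof (cases "L = M")
  case True
  \<comment> \<open>Two different proportions guarantee some \<open>N\<close> other than
    \<open>L\<close>, whose meet with \<open>L\<close> is the required point. They are told apart by
    the point \<open>(0, 1, 0)\<close>, which lies on the first but not on the second.\<close>
  have "abs_proportion (1, 0, 0) \<noteq> (abs_proportion (0, 1, 0) :: 'a proportion)"
  proof
    assume "abs_proportion (1, 0, 0) = (abs_proportion (0, 1, 0) :: 'a proportion)"
    then have "lies_on (abs_proportion (0, 1, 0)) (abs_proportion (1, 0, 0) :: 'a line) \<longleftrightarrow>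
        lies_on (abs_proportion (0, 1, 0)) (abs_proportion (0, 1, 0) :: 'a line)"
      by simp
    then show False
      by (simp add: lies_on_abs_proportion zero_prod_def)
  qed
  then obtain N where "N \<noteq> L" by metis
  then show ?thesis
    using True meet_lies_on[of N L] by auto
qed (use meet_lies_on in blast)

lemma not_concurrent_imp_distinct:
  assumes "\<not> concurrent L M N"
  shows "L \<noteq> M" "L \<noteq> N" "M \<noteq> N"
  using assms ex_lies_on_both unfolding concurrent_def by metis+

lemma concurrent_permute: "concurrent L M N \<longleftrightarrow> concurrent M L N"
  "concurrent L M N \<longleftrightarrow> concurrent N L M"
  by (auto simp: concurrent_def)

text \<open>A zero determinant would put the common point of the first two lines on the third; a
  nonzero one gives the coefficients by Cramer's rule.\<close>

lemma not_concurrent_imp_spans: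
  assumes nz: "u \<noteq> 0" "v \<noteq> 0" "w \<noteq> 0"
    and nc: "\<not> concurrent (abs_proportion u) (abs_proportion v) (abs_proportion w)"
  shows "\<exists>a b c. t = scale3 a u + scale3 b v + scale3 c w"
proof -
  obtain u1 u2 u3 v1 v2 v3 w1 w2 w3 t1 t2 t3
    where [simp]: "u = (u1, u2, u3)" "v = (v1, v2, v3)" "w = (w1, w2, w3)" "t = (t1, t2, t3)"
    by (cases u; cases v; cases w; cases t)
  define det where "det x1 x2 x3 y1 y2 y3 z1 z2 z3 =
    x1 * (y2 * z3 - y3 * z2) + x2 * (y3 * z1 - y1 * z3) + x3 * (y1 * z2 - y2 * z1)"
    for x1 x2 x3 y1 y2 y3 z1 z2 z3 :: 'a
  define d where "d = det u1 u2 u3 v1 v2 v3 w1 w2 w3"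
  have "d \<noteq> 0"
  proof
    assume "d = 0"
    \<comment> \<open>The cross product of \<open>u\<close> and \<open>v\<close> with its last entry
      negated, which offsets the minus sign in \<open>lorentz\<close>: pairing \<open>p\<close> with
      a vector gives its determinant with \<open>u\<close> and \<open>v\<close>.\<close>
    define p where "p = (u2 * v3 - u3 * v2, u3 * v1 - u1 * v3, - (u1 * v2 - u2 * v1))"
    have "p \<noteq> 0"
    proof
      assume "p = 0"
      then have "proportional u v"
        using nz by (simp add: proportional_iff_cross zero_prod_def p_def del: proportional.simps)
      then have "abs_proportion u = abs_proportion v"
        using Quotient3_rel_abs[OF Quotient3_proportion] by metis
      then show False
        using not_concurrent_imp_distinct[OF nc] by simp
    qed
    moreover have "lorentz p u = 0" "lorentz p v = 0" "lorentz p w = d"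
      by (simp_all add: p_def d_def det_def algebra_simps)
    ultimately have "concurrent (abs_proportion u) (abs_proportion v) (abs_proportion w)"
      unfolding concurrent_def using nz \<open>d = 0\<close>
      by (intro exI[of _ "abs_proportion p"]) (simp add: lies_on_abs_proportion del: lorentz.simps)
    then show False using nc by simp
  qed
  \<comment> \<open>Cramer's rule: \<open>t\<close> replaces \<open>u\<close>, \<open>v\<close>,
    \<open>w\<close> in turn in the determinant \<open>d\<close>.\<close>
  define a where "a = det t1 t2 t3 v1 v2 v3 w1 w2 w3"
  define b where "b = det u1 u2 u3 t1 t2 t3 w1 w2 w3"
  define c where "c = det u1 u2 u3 v1 v2 v3 t1 t2 t3"
  have "d * t1 = a * u1 + b * v1 + c * w1" "d * t2 = a * u2 + b * v2 + c * w2"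
    "d * t3 = a * u3 + b * v3 + c * w3"
    unfolding a_def b_def c_def d_def det_def by (simp_all add: algebra_simps)
  then have "t = scale3 (a / d) u + scale3 (b / d) v + scale3 (c / d) w"
    using \<open>d \<noteq> 0\<close> by (simp add: field_simps)
  then show ?thesis by blast
qed

lemma lies_on_combination:
  assumes "u \<noteq> 0" "v \<noteq> 0" "w \<noteq> 0" "w = scale3 s u + scale3 t v"
    and "lies_on p (abs_proportion u)" "lies_on p (abs_proportion v)"
  shows "lies_on p (abs_proportion w)"
proof -
  obtain q where "q \<noteq> 0" "p = abs_proportion q"
    by (rule proportion_cases)
  then show ?thesis
    using assms by (simp add: lies_on_abs_proportion lorentz_add_right lorentz_scale3_right)
qed

text \<open>Singling out \<open>u\<close> lets permutations of \<open>u\<close>, \<open>v\<close>,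
  \<open>w\<close> yield all three lines \<open>D1\<close>, \<open>D2\<close>,
  \<open>D3\<close>.\<close>

lemma cevian_eq:
  assumes nz: "u \<noteq> 0" "v \<noteq> 0" "w \<noteq> 0" "t \<noteq> 0"
    and nc: "\<not> concurrent (abs_proportion u) (abs_proportion v) (abs_proportion w)"
    and t: "t = scale3 a u + (scale3 b v + scale3 c w)"
    and tu: "abs_proportion t \<noteq> abs_proportion u"
  shows "scale3 b v + scale3 c w \<noteq> 0"
    and "join (meet (abs_proportion t) (abs_proportion u))
              (meet (abs_proportion v) (abs_proportion w)) =
         abs_proportion (scale3 b v + scale3 c w)"
proof -
  define e where "e = scale3 b v + scale3 c w"
  show *: "scale3 b v + scale3 c w \<noteq> 0"
  proof
    assume "scale3 b v + scale3 c w = 0"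
    then have "t = scale3 a u" using t by simp
    moreover from this have "a \<noteq> 0"
      using nz by (cases u) (auto simp: zero_prod_def)
    ultimately show False
      using tu nz abs_proportion_scale3 by metis
  qed
  have vw: "abs_proportion v \<noteq> abs_proportion w"
    using not_concurrent_imp_distinct[OF nc] by simp
  \<comment> \<open>The same vector written as \<open>t - a u\<close>, which places its line in the
    pencil of \<open>t\<close> and \<open>u\<close>.\<close>
  have e: "e = scale3 1 t + scale3 (- a) u"
    unfolding e_def t by (cases u; cases v; cases w) (simp add: algebra_simps)
  show "join (meet (abs_proportion t) (abs_proportion u))
            (meet (abs_proportion v) (abs_proportion w)) =
        abs_proportion (scale3 b v + scale3 c w)"
  proof (rule join_eqI)
    \<comment> \<open>If the two meets coincided, that point would lie on the lines of
      \<open>u\<close>, \<open>v\<close> and \<open>w\<close>.\<close>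
    show "meet (abs_proportion t) (abs_proportion u) \<noteq> meet (abs_proportion v) (abs_proportion w)"
      using nc meet_lies_on[OF tu] meet_lies_on[OF vw] unfolding concurrent_def by metis
    show "lies_on (meet (abs_proportion t) (abs_proportion u))
        (abs_proportion (scale3 b v + scale3 c w))"
      using lies_on_combination[OF \<open>t \<noteq> 0\<close> \<open>u \<noteq> 0\<close> _ e] meet_lies_on[OF tu] *
      by (simp add: e_def)
    show "lies_on (meet (abs_proportion v) (abs_proportion w))
        (abs_proportion (scale3 b v + scale3 c w))"
      using lies_on_combination[OF \<open>v \<noteq> 0\<close> \<open>w \<noteq> 0\<close> * refl] meet_lies_on[OF vw] by simp
  qed
qed

text \<open>Shearing away the \<open>u\<close> part of \<open>e\<close> leaves \<open>t v\<close>,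
  and shearing away the \<open>v\<close> part leaves \<open>s u\<close>. Both spreads thus share
  \<open>gram u v\<close> and \<open>lorentz e e\<close>.\<close>

lemma spread_combination:
  assumes "u \<noteq> 0" "v \<noteq> 0" "lorentz u u \<noteq> 0" "lorentz v v \<noteq> 0"
    and "e = scale3 s u + scale3 t v" "e \<noteq> 0" "lorentz e e \<noteq> 0"
  shows "spread (abs_proportion u) (abs_proportion e) =
      t\<^sup>2 * gram u v / (lorentz u u * lorentz e e)"
    and "spread (abs_proportion e) (abs_proportion v) =
      s\<^sup>2 * gram u v / (lorentz v v * lorentz e e)"
proof -
  have "gram u e = t\<^sup>2 * gram u v"
    using assms(5) by (simp add: gram_add_scale3 gram_scale3_right)
  then show "spread (abs_proportion u) (abs_proportion e) =
      t\<^sup>2 * gram u v / (lorentz u u * lorentz e e)"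
    using assms by (simp add: spread_abs_proportion)
  have "gram e v = gram v (scale3 t v + scale3 s u)"
    using assms(5) by (simp add: gram_commute[of _ v] add.commute)
  also have "\<dots> = s\<^sup>2 * gram u v"
    by (simp add: gram_add_scale3 gram_scale3_right gram_commute[of v])
  finally show "spread (abs_proportion e) (abs_proportion v) =
      s\<^sup>2 * gram u v / (lorentz v v * lorentz e e)"
    using assms by (simp add: spread_abs_proportion mult.commute)
qed

theorem theorem79:
  fixes A0 A1 A2 A3 D1 D2 D3 :: "('a::field) line"
  assumes "CHAR('a) \<noteq> 2"
    and "\<not> concurrent A1 A2 A3"
    and "\<not> null_line A1" "\<not> null_line A2" "\<not> null_line A3"
    and "\<not> null_line A0"
    and "A0 \<noteq> A1" "A0 \<noteq> A2" "A0 \<noteq> A3"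
    and "\<not> null_point (meet A0 A1)" "\<not> null_point (meet A0 A2)" "\<not> null_point (meet A0 A3)"
    and "D1 = join (meet A0 A1) (meet A2 A3)"
    and "D2 = join (meet A0 A2) (meet A1 A3)"
    and "D3 = join (meet A0 A3) (meet A1 A2)"
    and "\<not> null_line D1" "\<not> null_line D2" "\<not> null_line D3"
  shows "spread A2 D1 * spread A3 D2 * spread A1 D3 =
         spread D1 A3 * spread D2 A1 * spread D3 A2"
proof -
  obtain t where t: "t \<noteq> 0" "A0 = abs_proportion t" by (rule proportion_cases)
  obtain u where u: "u \<noteq> 0" "A1 = abs_proportion u" by (rule proportion_cases)
  obtain v where v: "v \<noteq> 0" "A2 = abs_proportion v" by (rule proportion_cases)
  obtain w where w: "w \<noteq> 0" "A3 = abs_proportion w" by (rule proportion_cases)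
  have nc1: "\<not> concurrent (abs_proportion u) (abs_proportion v) (abs_proportion w)"
    and nc2: "\<not> concurrent (abs_proportion v) (abs_proportion u) (abs_proportion w)"
    and nc3: "\<not> concurrent (abs_proportion w) (abs_proportion u) (abs_proportion v)"
    using assms(2) u v w concurrent_permute by metis+
  obtain a b c where abc: "t = scale3 a u + scale3 b v + scale3 c w"
    using not_concurrent_imp_spans[OF u(1) v(1) w(1) nc1] by blast
  define e1 where "e1 = scale3 b v + scale3 c w"
  define e2 where "e2 = scale3 a u + scale3 c w"
  define e3 where "e3 = scale3 a u + scale3 b v"
  have e1: "e1 \<noteq> 0" "D1 = abs_proportion e1"
    using cevian_eq[OF u(1) v(1) w(1) t(1) nc1, of a b c] abc assms(7,13) t u v w
    by (simp_all add: e1_def add.assoc)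
  have e2: "e2 \<noteq> 0" "D2 = abs_proportion e2"
    using cevian_eq[OF v(1) u(1) w(1) t(1) nc2, of b a c] abc assms(8,14) t u v w
    by (simp_all add: e2_def add_ac)
  have e3: "e3 \<noteq> 0" "D3 = abs_proportion e3"
    using cevian_eq[OF w(1) u(1) v(1) t(1) nc3, of c a b] abc assms(9,15) t u v w
    by (simp_all add: e3_def add_ac)
  have Q: "lorentz u u \<noteq> 0" "lorentz v v \<noteq> 0" "lorentz w w \<noteq> 0"
    "lorentz e1 e1 \<noteq> 0" "lorentz e2 e2 \<noteq> 0" "lorentz e3 e3 \<noteq> 0"
    using assms(3-5,16-18) u v w e1 e2 e3 by (simp_all add: null_line_abs_proportion)
  note R1T1 = spread_combination[OF v(1) w(1) Q(2,3) e1_def e1(1) Q(4)]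
  \<comment> \<open>Reordered so that the pairs run cyclically through \<open>(v, w)\<close>,
    \<open>(w, u)\<close>, \<open>(u, v)\<close>, as the definitions of the spreads require.\<close>
  have e2': "e2 = scale3 c w + scale3 a u"
    by (simp add: e2_def add.commute)
  note R2T2 = spread_combination[OF w(1) u(1) Q(3,1) e2' e2(1) Q(5)]
  note R3T3 = spread_combination[OF u(1) v(1) Q(1,2) e3_def e3(1) Q(6)]
  \<comment> \<open>The left factors carry the squares of \<open>c\<close>, \<open>a\<close>,
    \<open>b\<close> and the right ones those of \<open>b\<close>, \<open>c\<close>,
    \<open>a\<close>. The Gram determinants agree factor by factor, and each of \<open>u\<close>,
    \<open>v\<close>, \<open>w\<close> contributes its denominator once on either side.\<close>
  show ?thesis
    unfolding u v w e1 e2 e3 R1T1 R2T2 R3T3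
    by (simp add: ac_simps)
qed

end
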